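(* Let $G=(V,E_G)$ be the rectangular grid graph with $m$ rows and $n$ columns, i.e. vertices $(i,j)$ with $1\le i\le n$, $1\le j\le m$, adjacent iff they differ by $1$ in exactly one coordinate. Let $E,F\in V$ with $d_G(E,F)\ge 2$, and let $G'=(V,E_G\cup\{EF\})$. Then the set of the four corners $\{(1,1),(n,1),(n,m),(1,m)\}$ is a resolving set of $G'$; consequently $\beta(G')\le 4$.
   Context: For a connected graph $H$, a set $R$ of vertices is resolving if every pair of distinct vertices $A\ne B$ has some $X\in R$ with $d_H(A,X)\ne d_H(B,X)$, where $d_H$ is shortest-path distance; the metric dimension $\beta(H)$ is the minimum size of a resolving set. *)

theory Defs
  imports "Graph_Theory.Graph_Theory"
begin

text \<open>
  A simple graph is a \<open>pair_graph\<close>: an undirected edge \<open>uv\<close> is the pair of opposite arcs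
  \<open>(u, v)\<close> and \<open>(v, u)\<close>. Since \<open>\<mu>\<close> is only specified for well-formed digraphs, \<open>graph_dist\<close>
  is meaningful only under \<open>pair_wf_digraph\<close>; this is shown below for the graphs of interest.
\<close>

definition graph_dist :: "'a pair_pre_digraph \<Rightarrow> 'a \<Rightarrow> 'a \<Rightarrow> ereal" where
  "graph_dist H u v = wf_digraph.\<mu> (with_proj H) (\<lambda>_. 1) u v"

definition resolving_set :: "'a pair_pre_digraph \<Rightarrow> 'a set \<Rightarrow> bool" where
  "resolving_set H R \<longleftrightarrow> R \<subseteq> pverts H \<and>
    (\<forall>A \<in> pverts H. \<forall>B \<in> pverts H. A \<noteq> B \<longrightarrow>
      (\<exists>X \<in> R. graph_dist H A X \<noteq> graph_dist H B X))"

text \<open>The minimum exists whenever \<open>H\<close> is connected and finite, as \<open>pverts H\<close> is then resolving.\<close>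

definition metric_dimension :: "'a pair_pre_digraph \<Rightarrow> nat" where
  "metric_dimension H = (LEAST k. \<exists>R. resolving_set H R \<and> finite R \<and> card R = k)"

text \<open>\<open>m\<close> rows and \<open>n\<close> columns; a vertex is \<open>(column, row)\<close>, counted from 1.\<close>

definition grid_adj :: "nat \<times> nat \<Rightarrow> nat \<times> nat \<Rightarrow> bool" where
  "grid_adj u v \<longleftrightarrow>
    (snd u = snd v \<and> (fst v = fst u + 1 \<or> fst u = fst v + 1)) \<or>
    (fst u = fst v \<and> (snd v = snd u + 1 \<or> snd u = snd v + 1))"

definition grid :: "nat \<Rightarrow> nat \<Rightarrow> (nat \<times> nat) pair_pre_digraph" where
  "grid m n = (let V = {1..n} \<times> {1..m} in
    \<lparr> pverts = V, parcs = {(u, v). u \<in> V \<and> v \<in> V \<and> grid_adj u v} \<rparr>)"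

definition add_edge :: "'a pair_pre_digraph \<Rightarrow> 'a \<Rightarrow> 'a \<Rightarrow> 'a pair_pre_digraph" where
  "add_edge G u v = G\<lparr> parcs := parcs G \<union> {(u, v), (v, u)} \<rparr>"

lemma pverts_grid [simp]: "pverts (grid m n) = {1..n} \<times> {1..m}"
  by (simp add: grid_def Let_def)

lemma parcs_grid:
  "parcs (grid m n) = {(u, v). u \<in> {1..n} \<times> {1..m} \<and> v \<in> {1..n} \<times> {1..m} \<and> grid_adj u v}"
  by (simp add: grid_def Let_def)

lemma pair_graph_grid: "pair_graph (grid m n)"
proof
  show "finite (parcs (grid m n))"
    by (rule finite_subset [of _ "({1..n} \<times> {1..m}) \<times> ({1..n} \<times> {1..m})"])
      (auto simp: parcs_grid)
  show "symmetric (with_proj (grid m n))"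
    unfolding symmetric_def by (auto intro!: symI simp: parcs_grid grid_adj_def)
qed (auto simp: parcs_grid grid_adj_def)

lemma pair_graph_add_edge:
  assumes "pair_graph G" "u \<in> pverts G" "v \<in> pverts G" "u \<noteq> v"
  shows "pair_graph (add_edge G u v)"
proof -
  interpret pair_graph G by fact
  show ?thesis
  proof
    show "symmetric (with_proj (add_edge G u v))"
      using pair_sym_arcs unfolding symmetric_def
      by (auto simp: add_edge_def sym_def)
  qed (use assms pair_finite_verts pair_finite_arcs pair_no_loops
        in \<open>auto simp: add_edge_def dest: in_arcsD1 in_arcsD2\<close>)
qed

lemma strongly_connected_grid:
  assumes "m \<ge> 1" "n \<ge> 1"
  shows "strongly_connected (with_proj (grid m n))"
proof -
  interpret pair_graph "grid m n" by (rule pair_graph_grid)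
  have row1: "(1, 1) \<rightarrow>\<^sup>*\<^bsub>with_proj (grid m n)\<^esub> (Suc i, 1)" if "Suc i \<le> n" for i
    using that
  proof (induction i)
    case 0
    have "(1, 1) \<in> pverts (grid m n)" using assms by auto
    then show ?case using reachable_refl by simp
  next
    case (Suc i)
    have "((Suc i, 1), (Suc (Suc i), 1)) \<in> parcs (grid m n)"
      using Suc.prems assms by (auto simp: parcs_grid grid_adj_def)
    with Suc show ?case by (metis Suc_leD reachable_adj_trans with_proj_simps(3))
  qed
  have all: "(1, 1) \<rightarrow>\<^sup>*\<^bsub>with_proj (grid m n)\<^esub> (Suc i, Suc j)" if "Suc i \<le> n" "Suc j \<le> m" for i j
    using that
  proof (induction j)
    case 0
    then show ?case using row1 by simp
  next
    case (Suc j)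
    have "((Suc i, Suc j), (Suc i, Suc (Suc j))) \<in> parcs (grid m n)"
      using Suc.prems by (auto simp: parcs_grid grid_adj_def)
    with Suc show ?case by (metis Suc_leD reachable_adj_trans with_proj_simps(3))
  qed
  have reach: "(1, 1) \<rightarrow>\<^sup>*\<^bsub>with_proj (grid m n)\<^esub> v" if "v \<in> pverts (grid m n)" for v
    using that all [of "fst v - 1" "snd v - 1"] by (cases v) auto
  show ?thesis
  proof (rule strongly_connectedI)
    show "verts (with_proj (grid m n)) \<noteq> {}" using assms by auto
  next
    fix u v
    assume "u \<in> verts (with_proj (grid m n))" and "v \<in> verts (with_proj (grid m n))"
    then have "(1, 1) \<rightarrow>\<^sup>*\<^bsub>with_proj (grid m n)\<^esub> u" "(1, 1) \<rightarrow>\<^sup>*\<^bsub>with_proj (grid m n)\<^esub> v"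
      using reach by (simp_all only: with_proj_simps)
    then show "u \<rightarrow>\<^sup>*\<^bsub>with_proj (grid m n)\<^esub> v"
      using symmetric_reachable [OF pair_sym_arcs] reachable_trans by blast
  qed
qed

lemma connected_add_edge_grid:
  assumes "u \<in> pverts (grid m n)" "v \<in> pverts (grid m n)" "u \<noteq> v"
  shows "connected (with_proj (add_edge (grid m n) u v))"
proof -
  interpret G: pair_graph "grid m n" by (rule pair_graph_grid)
  interpret H: pair_graph "add_edge (grid m n) u v"
    using pair_graph_add_edge [OF pair_graph_grid assms] .
  have "spanning (with_proj (grid m n)) (with_proj (add_edge (grid m n) u v))"
    unfolding spanning_def subgraph_def compatible_def
    using G.wf_digraph_axioms H.wf_digraph_axioms by (auto simp: add_edge_def)
  moreover have "strongly_connected (with_proj (grid m n))"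
    using assms by (intro strongly_connected_grid) auto
  ultimately have "strongly_connected (with_proj (add_edge (grid m n) u v))"
    by (rule H.strongly_connected_spanning_imp_strongly_connected)
  then show ?thesis
    unfolding connected_def strongly_connected_def
    by (auto intro: H.reachable_mk_symmetricI)
qed

lemma (in pair_wf_digraph) graph_dist_eq_INF_length:
  "graph_dist G u v = (INF p \<in> {p. awalk u p v}. ereal (real (length p)))"
proof -
  have "awalk_cost (\<lambda>_. 1) p = real (length p)" for p :: "('a \<times> 'a) list"
    by (induction p) (auto simp: awalk_cost_def)
  then show ?thesis
    by (simp add: graph_dist_def \<mu>_def)
qed

end

theory Submission
  imports Defs
begin

text \<open>
  The distance in \<open>G'\<close> is the minimum of the grid distance and the lengths of the two routes through
  the new edge, one per direction. Suppose \<open>A\<close> and \<open>B\<close> are not separated by any corner. By the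
  triangle inequality, the routes from \<open>A\<close> and \<open>B\<close> to the corners cannot use the new edge in both
  directions, so say it is only used from \<open>F\<close> to \<open>E\<close>. This helps towards a corner only if \<open>E\<close> is
  closer to it than \<open>F\<close>, and then \<open>E\<close> is farther than \<open>F\<close> from the opposite corner. Hence in each pair
  of opposite corners there is one whose distances to \<open>A\<close> and \<open>B\<close> are the grid distances. These
  determine the coordinate sum and the coordinate difference, so \<open>A = B\<close>.
\<close>

text \<open>Certifies a distance formula by local checks. The one-step bound, summed along a walk,
  makes \<open>\<phi>\<close> a lower bound for its length; descent strictly decreases
  \<open>\<phi>\<close> and can only stop at \<open>v\<close>, which yields a walk of length at most
  \<open>\<phi> u\<close>.\<close>

lemma (in pair_wf_digraph) graph_dist_eqI:
  fixes \<phi> :: "'a \<Rightarrow> nat"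
  assumes v: "v \<in> pverts G" "\<phi> v = 0" and u: "u \<in> pverts G"
    and lipschitz: "\<And>x y. (x, y) \<in> parcs G \<Longrightarrow> \<phi> x \<le> \<phi> y + 1"
    and descent: "\<And>x. x \<in> pverts G \<Longrightarrow> x \<noteq> v \<Longrightarrow> \<exists>y. (x, y) \<in> parcs G \<and> \<phi> y < \<phi> x"
  shows "graph_dist G u v = ereal (real (\<phi> u))"
proof -
  have lower: "\<phi> x \<le> length p" if "awalk x p v" for x p
    using that
  proof (induction p arbitrary: x)
    case Nil
    then show ?case using v by (simp add: awalk_Nil_iff)
  next
    case (Cons e p)
    obtain y where "e = (x, y)" "(x, y) \<in> parcs G" "awalk y p v"
      using Cons.prems by (cases e) (auto simp: awalk_Cons_iff)
    then show ?case
      using Cons.IH [of y] lipschitz [of x y] by simp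
  qed
  have upper: "\<exists>p. awalk u p v \<and> length p \<le> \<phi> u"
    using u
  proof (induction "\<phi> u" arbitrary: u rule: less_induct)
    case less
    show ?case
    proof (cases "u = v")
      case True
      then have "awalk u [] v" using v by (simp add: awalk_Nil_iff)
      then show ?thesis by fastforce
    next
      case False
      then obtain y where y: "(u, y) \<in> parcs G" "\<phi> y < \<phi> u"
        using descent less.prems by blast
      then have "y \<in> pverts G" using in_arcsD2 by blast
      then obtain p where "awalk y p v" "length p \<le> \<phi> y"
        using less.hyps y by blast
      then have "awalk u ((u, y) # p) v \<and> length ((u, y) # p) \<le> \<phi> u"
        using y by (simp add: awalk_Cons_iff)
      then show ?thesis by blast
    qed
  qed
  then obtain p where p: "awalk u p v" "length p \<le> \<phi> u" by blast
  have "(INF p \<in> {p. awalk u p v}. ereal (real (length p))) = ereal (real (\<phi> u))"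
  proof (rule antisym)
    show "(INF p \<in> {p. awalk u p v}. ereal (real (length p))) \<le> ereal (real (\<phi> u))"
      using p by (intro INF_lower2 [of p]) auto
    show "ereal (real (\<phi> u)) \<le> (INF p \<in> {p. awalk u p v}. ereal (real (length p)))"
      using lower by (intro INF_greatest) auto
  qed
  then show ?thesis by (simp add: graph_dist_eq_INF_length)
qed

text \<open>Three routes suffice because a shortest walk crosses the new edge at most once, in one
  of two directions.\<close>

definition shortcut_dist :: "('a \<Rightarrow> 'a \<Rightarrow> nat) \<Rightarrow> 'a \<Rightarrow> 'a \<Rightarrow> 'a \<Rightarrow> 'a \<Rightarrow> nat" where
  "shortcut_dist d E F A X = min (d A X) (min (d A E + 1 + d F X) (d A F + 1 + d E X))"

lemma shortcut_dist_swap: "shortcut_dist d E F A X = shortcut_dist d F E A X"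
  by (simp add: shortcut_dist_def min.commute)

text \<open>Comparing the route from \<open>A\<close> with the direct one from \<open>B\<close> to
  \<open>X\<close> gives \<open>d A F + 1 \<le> d B E\<close>; the same at \<open>Y\<close> with the
  roles exchanged gives \<open>d B E + 1 \<le> d A F\<close>.\<close>

lemma not_both_directions:
  fixes d :: "'a \<Rightarrow> 'a \<Rightarrow> nat"
  assumes triangle: "\<And>x y z. d x z \<le> d x y + d y z"
    and "shortcut_dist d E F A X = shortcut_dist d E F B X"
    and "shortcut_dist d E F A Y = shortcut_dist d E F B Y"
  shows "\<not> (shortcut_dist d E F A X = d A F + 1 + d E X \<and>
    shortcut_dist d E F B Y = d B E + 1 + d F Y)"
proof
  assume *: "shortcut_dist d E F A X = d A F + 1 + d E X \<and>
    shortcut_dist d E F B Y = d B E + 1 + d F Y"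
  have "shortcut_dist d E F B X \<le> d B X" "shortcut_dist d E F A Y \<le> d A Y"
    by (simp_all add: shortcut_dist_def)
  then show False
    using * assms(2,3) triangle [of B X E] triangle [of A Y F] by linarith
qed

text \<open>
  Truncated subtraction: one of the two differences in each coordinate vanishes.
\<close>

definition grid_dist :: "nat \<times> nat \<Rightarrow> nat \<times> nat \<Rightarrow> nat" where
  "grid_dist u v =
    (fst u - fst v) + (fst v - fst u) + ((snd u - snd v) + (snd v - snd u))"

lemma grid_dist_self [simp]: "grid_dist u u = 0"
  by (simp add: grid_dist_def)

lemma grid_dist_triangle: "grid_dist u w \<le> grid_dist u v + grid_dist v w"
  unfolding grid_dist_def by linarith

lemma grid_dist_adj: "grid_adj u v \<Longrightarrow> grid_dist u w \<le> grid_dist v w + 1"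
  unfolding grid_adj_def grid_dist_def by auto

lemma grid_dist_descent:
  assumes "u \<in> pverts (grid m n)" "v \<in> pverts (grid m n)" "u \<noteq> v"
  obtains w where "(u, w) \<in> parcs (grid m n)" "grid_dist w v < grid_dist u v"
proof -
  obtain i j k l where [simp]: "u = (i, j)" "v = (k, l)" by (metis surj_pair)
  consider "i < k" | "k < i" | "i = k" "j < l" | "i = k" "l < j"
    using assms(3) by fastforce
  then show ?thesis
  proof cases
    case 1
    then show ?thesis using assms(1,2)
      by (intro that [of "(Suc i, j)"]) (auto simp: parcs_grid grid_adj_def grid_dist_def)
  next
    case 2
    then show ?thesis using assms(1,2)
      by (intro that [of "(i - 1, j)"]) (auto simp: parcs_grid grid_adj_def grid_dist_def)
  next
    case 3
    then show ?thesis using assms(1,2)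
      by (intro that [of "(i, Suc j)"]) (auto simp: parcs_grid grid_adj_def grid_dist_def)
  next
    case 4
    then show ?thesis using assms(1,2)
      by (intro that [of "(i, j - 1)"]) (auto simp: parcs_grid grid_adj_def grid_dist_def)
  qed
qed

lemma graph_dist_add_edge_grid:
  assumes E: "E \<in> pverts (grid m n)" and F: "F \<in> pverts (grid m n)" and "E \<noteq> F"
    and A: "A \<in> pverts (grid m n)" and X: "X \<in> pverts (grid m n)"
  shows "graph_dist (add_edge (grid m n) E F) A X =
    ereal (real (shortcut_dist grid_dist E F A X))"
proof -
  let ?H = "add_edge (grid m n) E F" and ?\<phi> = "\<lambda>u. shortcut_dist grid_dist E F u X"
  interpret pair_graph ?H
    using pair_graph_add_edge [OF pair_graph_grid E F \<open>E \<noteq> F\<close>] .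
  have verts: "pverts ?H = pverts (grid m n)"
    and arcs: "parcs ?H = parcs (grid m n) \<union> {(E, F), (F, E)}"
    by (simp_all add: add_edge_def)
  show ?thesis
  proof (rule graph_dist_eqI)
    fix u v
    assume "(u, v) \<in> parcs ?H"
    then consider "grid_adj u v" | "u = E" "v = F" | "u = F" "v = E"
      by (auto simp: arcs parcs_grid)
    then show "?\<phi> u \<le> ?\<phi> v + 1"
    proof cases
      case 1
      then show ?thesis
        using grid_dist_adj [OF 1, of X] grid_dist_adj [OF 1, of E] grid_dist_adj [OF 1, of F]
        unfolding shortcut_dist_def by linarith
    qed (auto simp: shortcut_dist_def)
  next
    fix u
    assume "u \<in> pverts ?H" and "u \<noteq> X"
    then have u: "u \<in> pverts (grid m n)" by (simp add: verts)
    have step: "\<exists>v. (u, v) \<in> parcs ?H \<and> grid_dist v w < grid_dist u w"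
      if "w \<in> pverts (grid m n)" "u \<noteq> w" for w
      by (rule grid_dist_descent [OF u that]) (use arcs in blast)
    \<comment> \<open>A route attaining the minimum dictates the next vertex: one grid step towards
      \<open>X\<close>, \<open>E\<close> or \<open>F\<close>, or the new edge itself once its near
      end is reached.\<close>
    consider "?\<phi> u = grid_dist u X"
      | "?\<phi> u = grid_dist u E + 1 + grid_dist F X" | "?\<phi> u = grid_dist u F + 1 + grid_dist E X"
      unfolding shortcut_dist_def by linarith
    then show "\<exists>v. (u, v) \<in> parcs ?H \<and> ?\<phi> v < ?\<phi> u"
    proof cases
      case 1
      obtain v where "(u, v) \<in> parcs ?H" "grid_dist v X < grid_dist u X"
        using step [OF X \<open>u \<noteq> X\<close>] by blast
      with 1 show ?thesis
        by (intro exI [of _ v]) (simp add: shortcut_dist_def)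
    next
      case 2
      show ?thesis
      proof (cases "u = E")
        case True
        with 2 have "(u, F) \<in> parcs ?H \<and> ?\<phi> F < ?\<phi> u"
          by (simp add: arcs) (simp add: shortcut_dist_def)
        then show ?thesis by blast
      next
        case False
        then obtain v where "(u, v) \<in> parcs ?H" "grid_dist v E < grid_dist u E"
          using step [OF E] by blast
        with 2 show ?thesis
          by (intro exI [of _ v]) (simp add: shortcut_dist_def)
      qed
    next
      case 3
      show ?thesis
      proof (cases "u = F")
        case True
        with 3 have "(u, E) \<in> parcs ?H \<and> ?\<phi> E < ?\<phi> u"
          by (simp add: arcs) (simp add: shortcut_dist_def)
        then show ?thesis by blast
      next
        case False
        then obtain v where "(u, v) \<in> parcs ?H" "grid_dist v F < grid_dist u F"
          using step [OF F] by blast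
        with 3 show ?thesis
          by (intro exI [of _ v]) (simp add: shortcut_dist_def)
      qed
    qed
  qed (use A X in \<open>simp_all add: verts shortcut_dist_def\<close>)
qed

text \<open>Every vertex lies on a shortest grid path between opposite corners, so either of the two
  distances determines the other.\<close>

lemma grid_dist_opposite_corners:
  assumes "u \<in> pverts (grid m n)"
  shows "grid_dist u (1, 1) + grid_dist u (n, m) = (n - 1) + (m - 1)"
    and "grid_dist u (n, 1) + grid_dist u (1, m) = (n - 1) + (m - 1)"
  using assms by (auto simp: grid_dist_def)

text \<open>The first distance fixes the sum of the coordinates, the second their
  difference.\<close>

lemma grid_eqI:
  assumes "A \<in> pverts (grid m n)" "B \<in> pverts (grid m n)"
    and "grid_dist A (1, 1) = grid_dist B (1, 1)" "grid_dist A (n, 1) = grid_dist B (n, 1)"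
  shows "A = B"
  using assms by (cases A; cases B) (auto simp: grid_dist_def)

lemma corners_separate_one_direction:
  assumes V: "A \<in> pverts (grid m n)" "B \<in> pverts (grid m n)"
      "E \<in> pverts (grid m n)" "F \<in> pverts (grid m n)"
    and eq: "\<And>X. X \<in> {(1, 1), (n, 1), (n, m), (1, m)} \<Longrightarrow>
      shortcut_dist grid_dist E F A X = shortcut_dist grid_dist E F B X"
    and unused: "\<And>C X. C \<in> {A, B} \<Longrightarrow> X \<in> {(1, 1), (n, 1), (n, m), (1, m)} \<Longrightarrow>
      shortcut_dist grid_dist E F C X \<noteq> grid_dist C E + 1 + grid_dist F X"
  shows "A = B"
proof -
  have eq_dist: "grid_dist A X = grid_dist B X"
    if X: "X \<in> {(1, 1), (n, 1), (n, m), (1, m)}" and le: "grid_dist F X \<le> grid_dist E X" for X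
  proof -
    \<comment> \<open>The remaining detour, from \<open>F\<close> to \<open>E\<close>, costs at
      least \<open>grid_dist C F + 1 + grid_dist F X\<close>, which exceeds the direct
      distance.\<close>
    have "shortcut_dist grid_dist E F C X = grid_dist C X" if "C \<in> {A, B}" for C
      using unused [OF that X] le grid_dist_triangle [of C X F]
      unfolding shortcut_dist_def by linarith
    then show ?thesis using eq [OF X] by simp
  qed
  note opposite = V [THEN grid_dist_opposite_corners(1)] V [THEN grid_dist_opposite_corners(2)]
  \<comment> \<open>If \<open>E\<close> is closer to \<open>(1, 1)\<close> than \<open>F\<close>,
    the constant sum makes \<open>F\<close> closer to \<open>(n, m)\<close>; equality there carries
    back to \<open>(1, 1)\<close>.\<close>
  have "grid_dist A (1, 1) = grid_dist B (1, 1)"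
    using eq_dist [of "(1, 1)"] eq_dist [of "(n, m)"] opposite
    by (cases "grid_dist F (1, 1) \<le> grid_dist E (1, 1)") simp_all
  moreover have "grid_dist A (n, 1) = grid_dist B (n, 1)"
    using eq_dist [of "(n, 1)"] eq_dist [of "(1, m)"] opposite
    by (cases "grid_dist F (n, 1) \<le> grid_dist E (n, 1)") simp_all
  ultimately show ?thesis using V(1,2) grid_eqI by blast
qed

lemma corners_separate:
  assumes V: "A \<in> pverts (grid m n)" "B \<in> pverts (grid m n)"
      "E \<in> pverts (grid m n)" "F \<in> pverts (grid m n)"
    and eq: "\<And>X. X \<in> {(1, 1), (n, 1), (n, m), (1, m)} \<Longrightarrow>
      shortcut_dist grid_dist E F A X = shortcut_dist grid_dist E F B X"
  shows "A = B"
proof (cases "\<exists>C \<in> {A, B}. \<exists>X \<in> {(1, 1), (n, 1), (n, m), (1, m)}.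
    shortcut_dist grid_dist E F C X = grid_dist C E + 1 + grid_dist F X")
  case False
  then show ?thesis using corners_separate_one_direction [OF V eq] by blast
next
  case True
  then obtain D Y where D: "D \<in> {A, B}" and Y: "Y \<in> {(1, 1), (n, 1), (n, m), (1, m)}"
    and used: "shortcut_dist grid_dist E F D Y = grid_dist D E + 1 + grid_dist F Y"
    by blast
  have "shortcut_dist grid_dist F E C X \<noteq> grid_dist C F + 1 + grid_dist E X"
    if C: "C \<in> {A, B}" and X: "X \<in> {(1, 1), (n, 1), (n, m), (1, m)}" for C X
  proof -
    \<comment> \<open>This also covers \<open>C = D\<close>, so one use of the edge from
      \<open>E\<close> to \<open>F\<close> rules out the opposite direction for both
      \<open>A\<close> and \<open>B\<close>.\<close>
    have "shortcut_dist grid_dist E F C Z = shortcut_dist grid_dist E F D Z"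
      if "Z \<in> {(1, 1), (n, 1), (n, m), (1, m)}" for Z
      using C D eq [OF that] by auto
    then show ?thesis
      using not_both_directions [of grid_dist E F C X D Y, OF grid_dist_triangle] X Y used
      by (simp add: shortcut_dist_swap [of grid_dist F E])
  qed
  then show ?thesis
    using corners_separate_one_direction [OF V(1,2,4,3)] eq
    by (metis shortcut_dist_swap)
qed

theorem theorem2:
  fixes m n :: nat and E F :: "nat \<times> nat"
  assumes "E \<in> pverts (grid m n)" and "F \<in> pverts (grid m n)"
    and "graph_dist (grid m n) E F \<ge> 2"
  shows "resolving_set (add_edge (grid m n) E F) {(1, 1), (n, 1), (n, m), (1, m)} \<and>
    metric_dimension (add_edge (grid m n) E F) \<le> 4"
proof -
  let ?H = "add_edge (grid m n) E F" and ?R = "{(1, 1), (n, 1), (n, m), (1, m)}"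
  \<comment> \<open>Keeps the added edge from being a loop; otherwise the empty walk would give
    distance at most 0.\<close>
  have "E \<noteq> F"
  proof
    assume "E = F"
    interpret pair_graph "grid m n" by (rule pair_graph_grid)
    have "awalk E [] E" using assms(1) by (simp add: awalk_Nil_iff)
    then have "graph_dist (grid m n) E E \<le> 0"
      unfolding graph_dist_eq_INF_length by (intro INF_lower2 [of "[]"]) auto
    then have "(2 :: ereal) \<le> 0"
      using assms(3) \<open>E = F\<close> order_trans by blast
    then show False by simp
  qed
  have verts: "pverts ?H = pverts (grid m n)"
    by (simp add: add_edge_def)
  have R: "?R \<subseteq> pverts (grid m n)"
    using assms(1) by auto
  have dist: "graph_dist ?H C X = ereal (real (shortcut_dist grid_dist E F C X))"
    if "C \<in> pverts (grid m n)" "X \<in> ?R" for C X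
    using graph_dist_add_edge_grid [OF assms(1,2) \<open>E \<noteq> F\<close> that(1)] that(2) R by blast
  have "\<exists>X \<in> ?R. graph_dist ?H A X \<noteq> graph_dist ?H B X"
    if A: "A \<in> pverts (grid m n)" and B: "B \<in> pverts (grid m n)" and "A \<noteq> B" for A B
  proof (rule ccontr)
    assume "\<not> ?thesis"
    then have "shortcut_dist grid_dist E F A X = shortcut_dist grid_dist E F B X" if "X \<in> ?R" for X
      using dist [OF A that] dist [OF B that] that by auto
    then show False
      using corners_separate [OF A B assms(1,2)] \<open>A \<noteq> B\<close> by blast
  qed
  then have resolving: "resolving_set ?H ?R"
    unfolding resolving_set_def verts using R by blast
  have "metric_dimension ?H \<le> card ?R"
    unfolding metric_dimension_def by (rule Least_le) (use resolving in blast)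
  \<comment> \<open>Only an upper bound, since corners coincide when \<open>m = 1\<close> or
    \<open>n = 1\<close>.\<close>
  also have "card ?R \<le> 4"
    using card_length [of "[(1, 1), (n, 1), (n, m), (1, m)]"] by simp
  finally show ?thesis using resolving by blast
qed

end
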